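(* Let $X$ be an object of a category $\mathcal{C}$ such that $X$ is $X^d$ for some integer $d\ge 2$, and suppose that $X$ has some endomorphism other than the identity. If $N$ is any finite monoid, then $N$ has a faithful action on $X$.
   Context: "$X$ is $X^d$" means that $X$ is (isomorphic to) a product of $d$ copies of itself in $\mathcal{C}$; that is, there are morphisms $\tau_1,\dots,\tau_d\in\mathrm{End}(X)$ such that for every object $Y$ of $\mathcal{C}$ the map $\mathrm{Hom}(Y,X)\to\mathrm{Hom}(Y,X)^d$, $f\mapsto(\tau_1f,\dots,\tau_df)$, is a bijection. A faithful action of a monoid $N$ on $X$ is an injective monoid homomorphism $N\to\mathrm{End}(X)$ (taking $1$ to the identity). *)

theory Defs
  imports "HOL-Algebra.Group"
begin

record ('o, 'm) category_data =
  Obj :: "'o set"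
  Mor :: "'m set"
  Dom :: "'m \<Rightarrow> 'o"
  Cod :: "'m \<Rightarrow> 'o"
  Ident :: "'o \<Rightarrow> 'm"
  Comp :: "'m \<Rightarrow> 'm \<Rightarrow> 'm" (infixr "\<cdot>\<index>" 75)

definition Hom :: "('o, 'm, 'c) category_data_scheme \<Rightarrow> 'o \<Rightarrow> 'o \<Rightarrow> 'm set" where
  "Hom C X Y = {f \<in> Mor C. Dom C f = X \<and> Cod C f = Y}"

text \<open>
  Composition is in applicative order: \<open>g \<cdot> f\<close> is ``first \<open>f\<close>, then \<open>g\<close>''.  As usual for total
  functions, nothing is assumed about \<open>Comp\<close> on non-composable pairs or about \<open>Dom\<close>, \<open>Cod\<close>,
  \<open>Ident\<close> outside \<open>Mor\<close> and \<open>Obj\<close>.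
\<close>

locale category =
  fixes C :: "('o, 'm, 'c) category_data_scheme" (structure)
  assumes Dom_closed: "f \<in> Mor C \<Longrightarrow> Dom C f \<in> Obj C"
    and Cod_closed: "f \<in> Mor C \<Longrightarrow> Cod C f \<in> Obj C"
    and Ident_closed: "X \<in> Obj C \<Longrightarrow> Ident C X \<in> Hom C X X"
    and Comp_closed: "\<lbrakk>f \<in> Hom C X Y; g \<in> Hom C Y Z\<rbrakk> \<Longrightarrow> g \<cdot> f \<in> Hom C X Z"
    and Comp_Ident: "f \<in> Hom C X Y \<Longrightarrow> f \<cdot> Ident C X = f"
    and Ident_Comp: "f \<in> Hom C X Y \<Longrightarrow> Ident C Y \<cdot> f = f"
    and Comp_assoc: "\<lbrakk>f \<in> Hom C W X; g \<in> Hom C X Y; h \<in> Hom C Y Z\<rbrakk>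
      \<Longrightarrow> (h \<cdot> g) \<cdot> f = h \<cdot> (g \<cdot> f)"

definition End :: "('o, 'm, 'c) category_data_scheme \<Rightarrow> 'o \<Rightarrow> 'm monoid" where
  "End C X = \<lparr>carrier = Hom C X X, mult = Comp C, one = Ident C X\<rparr>"

text \<open>
  \<open>X\<close> is \<open>X\<^sup>d\<close>: the \<open>d\<close>-fold power of \<open>Hom(Y, X)\<close> is the set of extensional functions from
  \<open>{1..d}\<close> to \<open>Hom(Y, X)\<close>.
\<close>

definition is_self_power :: "('o, 'm, 'c) category_data_scheme \<Rightarrow> 'o \<Rightarrow> nat \<Rightarrow> bool" where
  "is_self_power C X d \<longleftrightarrow>
     (\<exists>\<tau>. (\<forall>i\<in>{1..d}. \<tau> i \<in> Hom C X X) \<and>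
          (\<forall>Y\<in>Obj C. bij_betw (\<lambda>f. \<lambda>i\<in>{1..d}. \<tau> i \<cdot>\<^bsub>C\<^esub> f)
                         (Hom C Y X) ({1..d} \<rightarrow>\<^sub>E Hom C Y X)))"

text \<open>The library's \<open>hom\<close> does not require preservation of the unit, so it is required here.\<close>

definition faithful_action ::
  "('n, 'z) monoid_scheme \<Rightarrow> ('o, 'm, 'c) category_data_scheme \<Rightarrow> 'o \<Rightarrow> ('n \<Rightarrow> 'm) \<Rightarrow> bool" where
  "faithful_action N C X \<phi> \<longleftrightarrow>
     \<phi> \<in> hom N (End C X) \<and> \<phi> \<one>\<^bsub>N\<^esub> = \<one>\<^bsub>End C X\<^esub> \<and> inj_on \<phi> (carrier N)"

lemma (in category) monoid_End:
  assumes "X \<in> Obj C"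
  shows "monoid (End C X)"
  by (rule monoidI)
     (use assms Ident_closed in
       \<open>auto simp: End_def intro: Comp_closed Comp_assoc Comp_Ident Ident_Comp\<close>)

end

theory Submission
  imports Defs
begin

text \<open>
  The whole argument takes place in the monoid \<open>M = End X\<close>.  Iterating \<open>X \<cong> X\<^sup>d\<close> gives
  \<open>X \<cong> X\<^sup>I\<close> for \<open>I\<close> the set of words of any fixed length \<open>l\<close> over \<open>{1..d}\<close>, and \<open>d \<ge> 2\<close> makes
  \<open>I\<close> as large as desired (\<open>coordinates_words\<close>).  A right action of \<open>N\<close> on the index set \<open>I\<close>
  becomes a left action on \<open>X\<^sup>I\<close> by rearranging coordinates: \<open>n\<close> sends \<open>(x\<^sub>i)\<^sub>i\<close> to
  \<open>(x\<^bsub>in\<^esub>)\<^sub>i\<close> (\<open>hom_of_index_action\<close>).  As \<open>X\<close> has an endomorphism other than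
  the identity, the coordinate projections \<open>X\<^sup>I \<rightarrow> X\<close> are pairwise distinct
  (\<open>coordinates_inj_on\<close>), so different self-maps of \<open>I\<close> rearrange coordinates differently.

  It remains to let \<open>N\<close> act faithfully on some \<open>I\<close>.  It acts faithfully on itself by right
  multiplication, since \<open>\<one>n = n\<close>; embedding \<open>N\<close> in a set \<open>I\<close> of words and fixing the words outside
  the image extends this action to \<open>I\<close> (\<open>faithful_action_on_superset\<close>).  The fixed
  words absorb the mismatch between \<open>card N\<close> and the powers of \<open>d\<close>.
\<close>

text \<open>
  This is the universal property of the product \<open>X \<cong> X\<^sup>I\<close> with projections \<open>\<tau>\<close>, tested only on
  morphisms from \<open>X\<close> itself, so that it is a property of the monoid \<open>End X\<close> alone.
\<close>

definition coordinates :: "('m, 'b) monoid_scheme \<Rightarrow> 'i set \<Rightarrow> ('i \<Rightarrow> 'm) \<Rightarrow> bool" where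
  "coordinates M I \<tau> \<longleftrightarrow> \<tau> \<in> I \<rightarrow> carrier M \<and>
     (\<forall>g \<in> I \<rightarrow> carrier M. \<exists>!f. f \<in> carrier M \<and> (\<forall>i\<in>I. \<tau> i \<otimes>\<^bsub>M\<^esub> f = g i))"

lemma coordinates_closed: "coordinates M I \<tau> \<Longrightarrow> i \<in> I \<Longrightarrow> \<tau> i \<in> carrier M"
  by (auto simp: coordinates_def)

lemma coordinates_tuple:
  assumes "coordinates M I \<tau>" "\<And>i. i \<in> I \<Longrightarrow> g i \<in> carrier M"
  obtains f where "f \<in> carrier M" "\<And>i. i \<in> I \<Longrightarrow> \<tau> i \<otimes>\<^bsub>M\<^esub> f = g i"
proof -
  have "\<exists>!f. f \<in> carrier M \<and> (\<forall>i\<in>I. \<tau> i \<otimes>\<^bsub>M\<^esub> f = g i)"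
    using assms unfolding coordinates_def by blast
  then show thesis using that by blast
qed

lemma (in monoid) coordinates_eqI:
  assumes "coordinates G I \<tau>" "f \<in> carrier G" "f' \<in> carrier G"
    and "\<And>i. i \<in> I \<Longrightarrow> \<tau> i \<otimes> f = \<tau> i \<otimes> f'"
  shows "f = f'"
proof -
  have "(\<lambda>i. \<tau> i \<otimes> f') \<in> I \<rightarrow> carrier G"
    using assms by (auto dest: coordinates_closed)
  then have "\<exists>!h. h \<in> carrier G \<and> (\<forall>i\<in>I. \<tau> i \<otimes> h = \<tau> i \<otimes> f')"
    using assms(1) unfolding coordinates_def by (elim conjE bspec)
  moreover have "f \<in> carrier G \<and> (\<forall>i\<in>I. \<tau> i \<otimes> f = \<tau> i \<otimes> f')"
    using assms by simp
  moreover have "f' \<in> carrier G \<and> (\<forall>i\<in>I. \<tau> i \<otimes> f' = \<tau> i \<otimes> f')"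
    using assms by simp
  ultimately show ?thesis by (elim ex1E) metis
qed

text \<open>
  If \<open>\<tau> i = \<tau> j\<close> for distinct \<open>i\<close> and \<open>j\<close>, then no tuple can have \<open>e\<close> at \<open>i\<close> and \<open>\<one>\<close> at \<open>j\<close>.
\<close>

lemma (in monoid) coordinates_inj_on:
  assumes \<tau>: "coordinates G I \<tau>" and e: "e \<in> carrier G" "e \<noteq> \<one>"
  shows "inj_on \<tau> I"
proof (rule inj_onI, rule ccontr)
  fix i j assume ij: "i \<in> I" "j \<in> I" "\<tau> i = \<tau> j" "i \<noteq> j"
  obtain f where "\<And>k. k \<in> I \<Longrightarrow> \<tau> k \<otimes> f = (if k = i then e else \<one>)"
    by (rule coordinates_tuple[OF \<tau>, of "\<lambda>k. if k = i then e else \<one>"]) (use e in auto)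
  from this[of i] this[of j] show False using ij e by auto
qed

text \<open>
  Write \<open>W\<close> for the words of length \<open>l\<close>.  Splitting each factor of \<open>X \<cong> X\<^sup>W\<close> as \<open>X \<cong> X\<^sup>D\<close>
  gives \<open>X \<cong> (X\<^sup>D)\<^sup>W\<close>, and its coordinate at \<open>x # xs\<close> is reached by first projecting to the
  block \<open>xs\<close> and then to the entry \<open>x\<close> of that block.
\<close>

lemma (in monoid) coordinates_words:
  assumes \<tau>: "coordinates G D \<tau>"
  shows "coordinates G {xs. set xs \<subseteq> D \<and> length xs = l} (\<lambda>xs. foldr (\<lambda>x f. \<tau> x \<otimes> f) xs \<one>)"
    (is "coordinates G (?W l) ?\<sigma>")
proof (induction l)
  case 0
  have "\<exists>!f. f \<in> carrier G \<and> \<one> \<otimes> f = g []" if "g [] \<in> carrier G" for g :: "'c list \<Rightarrow> 'a"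
    using that by (intro ex1I[of _ "g []"]) auto
  moreover have "?W 0 = {[]}" by auto
  ultimately show ?case by (auto simp: coordinates_def Pi_iff)
next
  case (Suc l)
  have \<sigma>_closed: "?\<sigma> xs \<in> carrier G" if "xs \<in> ?W l" for xs
    using coordinates_closed[OF Suc that] .
  have W_Suc: "ys \<in> ?W (Suc l) \<longleftrightarrow> (\<exists>x xs. ys = x # xs \<and> x \<in> D \<and> xs \<in> ?W l)" for ys
    by (cases ys) auto
  show ?case unfolding coordinates_def
  proof (intro conjI ballI)
    show "?\<sigma> \<in> ?W (Suc l) \<rightarrow> carrier G"
    proof
      fix ys assume "ys \<in> ?W (Suc l)"
      then obtain x xs where ys: "ys = x # xs" "x \<in> D" "xs \<in> ?W l"
        using W_Suc by blast
      then show "?\<sigma> ys \<in> carrier G"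
        using coordinates_closed[OF \<tau>] \<sigma>_closed by simp
    qed
    fix g assume g: "g \<in> ?W (Suc l) \<rightarrow> carrier G"
    have g_closed: "g (x # xs) \<in> carrier G" if "x \<in> D" "xs \<in> ?W l" for x xs
      by (rule Pi_mem[OF g]) (use that in auto)
    have "\<forall>xs\<in>?W l. \<exists>h. h \<in> carrier G \<and> (\<forall>x\<in>D. \<tau> x \<otimes> h = g (x # xs))"
    proof
      fix xs assume "xs \<in> ?W l"
      with coordinates_tuple[OF \<tau>, of "\<lambda>x. g (x # xs)"] g_closed
      obtain h where "h \<in> carrier G" "\<And>x. x \<in> D \<Longrightarrow> \<tau> x \<otimes> h = g (x # xs)" by blast
      then show "\<exists>h. h \<in> carrier G \<and> (\<forall>x\<in>D. \<tau> x \<otimes> h = g (x # xs))" by blast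
    qed
    from bchoice[OF this] obtain h where h: "\<And>xs. xs \<in> ?W l \<Longrightarrow> h xs \<in> carrier G"
      "\<And>x xs. \<lbrakk>x \<in> D; xs \<in> ?W l\<rbrakk> \<Longrightarrow> \<tau> x \<otimes> h xs = g (x # xs)"
      by blast
    obtain f where f: "f \<in> carrier G" "\<And>xs. xs \<in> ?W l \<Longrightarrow> ?\<sigma> xs \<otimes> f = h xs"
      by (rule coordinates_tuple[OF Suc, of h]) (erule h(1), rule that)
    have step: "?\<sigma> (x # xs) \<otimes> f' = \<tau> x \<otimes> (?\<sigma> xs \<otimes> f')"
      if "x \<in> D" "xs \<in> ?W l" "f' \<in> carrier G" for x xs f'
      using that coordinates_closed[OF \<tau>] \<sigma>_closed by (simp add: m_assoc)
    show "\<exists>!f. f \<in> carrier G \<and> (\<forall>ys\<in>?W (Suc l). ?\<sigma> ys \<otimes> f = g ys)"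
    proof (intro ex1I[of _ f] conjI ballI)
      show "f \<in> carrier G" by fact
      show "?\<sigma> ys \<otimes> f = g ys" if "ys \<in> ?W (Suc l)" for ys
      proof -
        from iffD1[OF W_Suc that]
        obtain x xs where ys: "ys = x # xs" "x \<in> D" "xs \<in> ?W l" by (elim exE conjE)
        show ?thesis
          by (simp only: ys(1) step[OF ys(2,3) f(1)] f(2)[OF ys(3)] h(2)[OF ys(2,3)])
      qed
      fix f' assume f': "f' \<in> carrier G \<and> (\<forall>ys\<in>?W (Suc l). ?\<sigma> ys \<otimes> f' = g ys)"
      show "f' = f"
      proof (rule coordinates_eqI[OF Suc])
        fix xs assume xs: "xs \<in> ?W l"
        show "?\<sigma> xs \<otimes> f' = ?\<sigma> xs \<otimes> f"
        proof (rule coordinates_eqI[OF \<tau>])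
          fix x assume x: "x \<in> D"
          then have "x # xs \<in> ?W (Suc l)" using xs by auto
          then have "?\<sigma> (x # xs) \<otimes> f' = g (x # xs)" using f' by blast
          then show "\<tau> x \<otimes> (?\<sigma> xs \<otimes> f') = \<tau> x \<otimes> (?\<sigma> xs \<otimes> f)"
            using step[OF x xs, of f'] f' by (simp only: f(2)[OF xs] h(2)[OF x xs])
        qed (use f(1) f' \<sigma>_closed[OF xs] in auto)
      qed (use f f' in auto)
    qed
  qed
qed

text \<open>
  The \<open>i\<close>-th coordinate of \<open>\<phi> m (\<phi> n x)\<close> is the \<open>im\<close>-th coordinate of \<open>\<phi> n x\<close>, that is, the
  \<open>imn\<close>-th coordinate of \<open>x\<close>.  This is why a \<^emph>\<open>right\<close> action on the indices makes \<open>\<phi>\<close>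
  multiplicative.
\<close>

lemma (in monoid) hom_of_index_action:
  fixes N :: "('n, 'z) monoid_scheme"
  assumes N: "monoid N"
    and \<tau>: "coordinates G I \<tau>" and inj: "inj_on \<tau> I"
    and closed: "\<And>n i. \<lbrakk>n \<in> carrier N; i \<in> I\<rbrakk> \<Longrightarrow> \<rho> n i \<in> I"
    and mult: "\<And>m n i. \<lbrakk>m \<in> carrier N; n \<in> carrier N; i \<in> I\<rbrakk>
      \<Longrightarrow> \<rho> (m \<otimes>\<^bsub>N\<^esub> n) i = \<rho> n (\<rho> m i)"
    and one: "\<And>i. i \<in> I \<Longrightarrow> \<rho> \<one>\<^bsub>N\<^esub> i = i"
    and faithful: "\<And>m n. \<lbrakk>m \<in> carrier N; n \<in> carrier N; \<forall>i\<in>I. \<rho> m i = \<rho> n i\<rbrakk> \<Longrightarrow> m = n"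
  shows "\<exists>\<phi> \<in> hom N G. \<phi> \<one>\<^bsub>N\<^esub> = \<one>\<^bsub>G\<^esub> \<and> inj_on \<phi> (carrier N)"
proof -
  interpret N: monoid N by fact
  have \<tau>_closed: "\<tau> i \<in> carrier G" if "i \<in> I" for i
    using coordinates_closed[OF \<tau> that] .
  have "\<exists>f. f \<in> carrier G \<and> (\<forall>i\<in>I. \<tau> i \<otimes>\<^bsub>G\<^esub> f = \<tau> (\<rho> n i))" if "n \<in> carrier N" for n
    by (rule coordinates_tuple[OF \<tau>, of "\<lambda>i. \<tau> (\<rho> n i)"]) (use \<tau>_closed closed[OF that] in blast)+
  then obtain \<phi> where \<phi>_closed: "\<And>n. n \<in> carrier N \<Longrightarrow> \<phi> n \<in> carrier G"
    and \<phi>: "\<And>n i. \<lbrakk>n \<in> carrier N; i \<in> I\<rbrakk> \<Longrightarrow> \<tau> i \<otimes>\<^bsub>G\<^esub> \<phi> n = \<tau> (\<rho> n i)"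
    by metis
  have "\<phi> (m \<otimes>\<^bsub>N\<^esub> n) = \<phi> m \<otimes>\<^bsub>G\<^esub> \<phi> n" if mn: "m \<in> carrier N" "n \<in> carrier N" for m n
  proof (rule coordinates_eqI[OF \<tau>])
    fix i assume i: "i \<in> I"
    have "\<tau> i \<otimes>\<^bsub>G\<^esub> (\<phi> m \<otimes>\<^bsub>G\<^esub> \<phi> n) = \<tau> (\<rho> m i) \<otimes>\<^bsub>G\<^esub> \<phi> n"
      using m_assoc[of "\<tau> i" "\<phi> m" "\<phi> n"] \<tau>_closed \<phi>_closed \<phi> mn i by simp
    also have "\<dots> = \<tau> (\<rho> (m \<otimes>\<^bsub>N\<^esub> n) i)"
      using \<phi> closed mult mn i by simp
    finally show "\<tau> i \<otimes>\<^bsub>G\<^esub> \<phi> (m \<otimes>\<^bsub>N\<^esub> n) = \<tau> i \<otimes>\<^bsub>G\<^esub> (\<phi> m \<otimes>\<^bsub>G\<^esub> \<phi> n)"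
      using \<phi> mn i by simp
  qed (use mn \<phi>_closed in auto)
  then have "\<phi> \<in> hom N G" using \<phi>_closed by (auto simp: hom_def)
  moreover have "\<phi> \<one>\<^bsub>N\<^esub> = \<one>\<^bsub>G\<^esub>"
    by (rule coordinates_eqI[OF \<tau>]) (use \<phi>_closed \<phi> one \<tau>_closed in auto)
  moreover have "inj_on \<phi> (carrier N)"
  proof (rule inj_onI, rule faithful)
    fix m n assume mn: "m \<in> carrier N" "n \<in> carrier N" "\<phi> m = \<phi> n"
    show "\<forall>i\<in>I. \<rho> m i = \<rho> n i"
    proof
      fix i assume i: "i \<in> I"
      then have "\<tau> (\<rho> m i) = \<tau> (\<rho> n i)" using \<phi> mn by metis
      then show "\<rho> m i = \<rho> n i" by (rule inj_onD[OF inj]) (use closed mn i in auto)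
    qed
  qed
  ultimately show ?thesis by blast
qed

lemma (in monoid) faithful_action_on_superset:
  assumes \<iota>: "inj_on \<iota> (carrier G)" "\<iota> ` carrier G \<subseteq> I"
  obtains \<rho> where
    "\<And>n i. \<lbrakk>n \<in> carrier G; i \<in> I\<rbrakk> \<Longrightarrow> \<rho> n i \<in> I"
    "\<And>m n i. \<lbrakk>m \<in> carrier G; n \<in> carrier G; i \<in> I\<rbrakk> \<Longrightarrow> \<rho> (m \<otimes> n) i = \<rho> n (\<rho> m i)"
    "\<And>i. i \<in> I \<Longrightarrow> \<rho> \<one> i = i"
    "\<And>m n. \<lbrakk>m \<in> carrier G; n \<in> carrier G; \<forall>i\<in>I. \<rho> m i = \<rho> n i\<rbrakk> \<Longrightarrow> m = n"
proof -
  define \<rho> where "\<rho> n i =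
    (if i \<in> \<iota> ` carrier G then \<iota> (inv_into (carrier G) \<iota> i \<otimes> n) else i)" for n i
  have inside: "\<rho> n (\<iota> a) = \<iota> (a \<otimes> n)" if "a \<in> carrier G" for a n
    using that \<iota> by (simp add: \<rho>_def)
  have outside: "\<rho> n i = i" if "i \<notin> \<iota> ` carrier G" for i n
    using that by (simp add: \<rho>_def)
  show thesis
  proof (rule that[of \<rho>])
    show "\<rho> n i \<in> I" if "n \<in> carrier G" "i \<in> I" for n i
      using that \<iota>(2) by (cases "i \<in> \<iota> ` carrier G") (auto simp: inside outside)
    show "\<rho> (m \<otimes> n) i = \<rho> n (\<rho> m i)" if "m \<in> carrier G" "n \<in> carrier G" for m n i
      using that by (cases "i \<in> \<iota> ` carrier G") (auto simp: inside outside m_assoc)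
    show "\<rho> \<one> i = i" for i
      by (cases "i \<in> \<iota> ` carrier G") (auto simp: inside outside)
    show "m = n" if "m \<in> carrier G" "n \<in> carrier G" "\<forall>i\<in>I. \<rho> m i = \<rho> n i" for m n
    proof -
      have "\<rho> m (\<iota> \<one>) = \<rho> n (\<iota> \<one>)" using that(3) \<iota>(2) by auto
      then show ?thesis using that \<iota>(1) by (simp add: inside inj_on_eq_iff)
    qed
  qed
qed

lemma (in monoid) finite_monoid_embeds:
  fixes N :: "('n, 'z) monoid_scheme"
  assumes N: "monoid N" "finite (carrier N)"
    and \<tau>: "coordinates G D \<tau>" "finite D" "card D \<ge> 2"
    and e: "e \<in> carrier G" "e \<noteq> \<one>"
  shows "\<exists>\<phi> \<in> hom N G. \<phi> \<one>\<^bsub>N\<^esub> = \<one> \<and> inj_on \<phi> (carrier N)"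
proof -
  interpret N: monoid N by fact
  \<comment> \<open>Any word length \<open>l\<close> with \<open>card (carrier N) \<le> card D ^ l\<close> would do.\<close>
  define l where "l = card (carrier N)"
  define W where "W = {xs. set xs \<subseteq> D \<and> length xs = l}"
  have "card (carrier N) \<le> 2 ^ l" unfolding l_def by (simp add: less_imp_le)
  also have "\<dots> \<le> card D ^ l" using \<tau>(3) by (rule power_mono) simp
  also have "\<dots> = card W" unfolding W_def using \<tau>(2) by (simp add: card_lists_length_eq)
  finally have "card (carrier N) \<le> card W" .
  moreover have "finite W" unfolding W_def using \<tau>(2) by (rule finite_lists_length_eq)
  ultimately obtain \<iota> where \<iota>: "\<iota> ` carrier N \<subseteq> W" "inj_on \<iota> (carrier N)"
    using card_le_inj[OF N(2)] by blast
  obtain \<rho> where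
    "\<And>n i. \<lbrakk>n \<in> carrier N; i \<in> W\<rbrakk> \<Longrightarrow> \<rho> n i \<in> W"
    "\<And>m n i. \<lbrakk>m \<in> carrier N; n \<in> carrier N; i \<in> W\<rbrakk> \<Longrightarrow> \<rho> (m \<otimes>\<^bsub>N\<^esub> n) i = \<rho> n (\<rho> m i)"
    "\<And>i. i \<in> W \<Longrightarrow> \<rho> \<one>\<^bsub>N\<^esub> i = i"
    "\<And>m n. \<lbrakk>m \<in> carrier N; n \<in> carrier N; \<forall>i\<in>W. \<rho> m i = \<rho> n i\<rbrakk> \<Longrightarrow> m = n"
    using N.faithful_action_on_superset[OF \<iota>(2,1)] by blast
  note \<rho> = this
  have "coordinates G W (\<lambda>xs. foldr (\<lambda>x f. \<tau> x \<otimes> f) xs \<one>)"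
    unfolding W_def by (rule coordinates_words[OF \<tau>(1)])
  from hom_of_index_action[OF N(1) this coordinates_inj_on[OF this e]] \<rho>
  show ?thesis by blast
qed

lemma (in category) coordinates_End_if_self_power:
  assumes X: "X \<in> Obj C" and pow: "is_self_power C X d"
  shows "\<exists>\<tau>. coordinates (End C X) {1..d} \<tau>"
proof -
  obtain \<tau> where \<tau>: "\<And>i. i \<in> {1..d} \<Longrightarrow> \<tau> i \<in> Hom C X X"
    and bij: "bij_betw (\<lambda>f. \<lambda>i\<in>{1..d}. \<tau> i \<cdot> f) (Hom C X X) ({1..d} \<rightarrow>\<^sub>E Hom C X X)"
    using pow X unfolding is_self_power_def by blast
  have "\<exists>!f. f \<in> Hom C X X \<and> (\<forall>i\<in>{1..d}. \<tau> i \<cdot> f = g i)"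
    if "g \<in> {1..d} \<rightarrow> Hom C X X" for g
  proof -
    have "restrict g {1..d} \<in> {1..d} \<rightarrow>\<^sub>E Hom C X X" using that by auto
    with bij_betw_imp_surj_on[OF bij] obtain f
      where f: "f \<in> Hom C X X" "restrict g {1..d} = (\<lambda>i\<in>{1..d}. \<tau> i \<cdot> f)"
      by blast
    have "\<exists>!f. f \<in> Hom C X X \<and> (\<lambda>i\<in>{1..d}. \<tau> i \<cdot> f) = restrict g {1..d}"
    proof (intro ex1I[of _ f] conjI f(1) f(2)[symmetric])
      fix f' assume "f' \<in> Hom C X X \<and> (\<lambda>i\<in>{1..d}. \<tau> i \<cdot> f') = restrict g {1..d}"
      then show "f' = f"
        using f by (intro inj_onD[OF bij_betw_imp_inj_on[OF bij]]) simp_all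
    qed
    moreover have "(\<lambda>i\<in>{1..d}. \<tau> i \<cdot> f) = restrict g {1..d} \<longleftrightarrow> (\<forall>i\<in>{1..d}. \<tau> i \<cdot> f = g i)" for f
      by (auto simp: restrict_def fun_eq_iff)
    ultimately show ?thesis by simp
  qed
  with \<tau> have "coordinates (End C X) {1..d} \<tau>"
    by (auto simp: coordinates_def End_def)
  then show ?thesis by blast
qed

theorem corollary4:
  fixes C :: "('o, 'm, 'c) category_data_scheme"
    and X :: 'o
    and d :: nat
    and N :: "('n, 'z) monoid_scheme"
  assumes "category C"
    and "X \<in> Obj C"
    and "d \<ge> 2"
    and "is_self_power C X d"
    and "\<exists>e \<in> Hom C X X. e \<noteq> Ident C X"
    and "monoid N"
    and "finite (carrier N)"
  shows "\<exists>\<phi>. faithful_action N C X \<phi>"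
proof -
  interpret category C by fact
  interpret E: monoid "End C X" by (rule monoid_End) fact
  obtain \<tau> where "coordinates (End C X) {1..d} \<tau>"
    using coordinates_End_if_self_power assms by blast
  moreover obtain e where "e \<in> carrier (End C X)" "e \<noteq> \<one>\<^bsub>End C X\<^esub>"
    using assms(5) by (auto simp: End_def)
  ultimately show ?thesis
    using E.finite_monoid_embeds[OF assms(6,7), of "{1..d}" \<tau> e] assms(3)
    unfolding faithful_action_def by auto
qed

end
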